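(* Let $\Lambda = A\mathbb{Z}^2 \subseteq \mathbb{R}^2$ be a lattice, where $A$ is an invertible real $2\times 2$ matrix, let $\epsilon>0$, and write $E = \Lambda + B_\epsilon(0)$. Then for any arc $\Theta\subseteq S^1$ there is some $t_0>0$ such that $$ B_{t_0}(0)^c \subseteq R_\Theta E. $$
   Context: $B_r(0)=\{x\in\mathbb{R}^2: |x|<r\}$ with $|\cdot|$ the Euclidean norm, and $B_r(0)^c$ is its complement in $\mathbb{R}^2$. $\Lambda + B_\epsilon(0)=\{\lambda+b:\lambda\in\Lambda, b\in B_\epsilon(0)\}$. $S^1$ is the unit circle in the plane, identified with the set of angles (mod $2\pi$). $R_\theta$ denotes the rotation of $\mathbb{R}^2$ about the origin by the angle $\theta$, and $R_\Theta E = \{R_\theta x: \theta\in\Theta,\ x\in E\}$. An arc of $S^1$ means a connected subset of $S^1$ of positive length. *)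

theory Defs
  imports "HOL-Analysis.Analysis"
begin

definition lattice_of :: "real^2^2 \<Rightarrow> (real^2) set" where
  "lattice_of A = (\<lambda>z. A *v z) ` {z. \<forall>i. z $ i \<in> \<int>}"

definition rot :: "real \<Rightarrow> real^2^2" where
  "rot t = vector [vector [cos t, - sin t], vector [sin t, cos t]]"

text \<open>Angles modulo \<open>2\<pi>\<close> are identified with points of the unit circle \<open>sphere 0 1\<close>
  of the plane through the following parametrisation.\<close>

definition circle_point :: "real \<Rightarrow> real^2" where
  "circle_point t = vector [cos t, sin t]"

definition circle_length :: "(real^2) set \<Rightarrow> ennreal" where
  "circle_length \<Theta> = emeasure lborel {t \<in> {0..<2 * pi}. circle_point t \<in> \<Theta>}"

definition circle_arc :: "(real^2) set \<Rightarrow> bool" where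
  "circle_arc \<Theta> \<longleftrightarrow> \<Theta> \<subseteq> sphere 0 1 \<and> connected \<Theta> \<and> circle_length \<Theta> > 0"

text \<open>The choice of the representative angle is immaterial here, by \<open>rot_cong\<close> below.\<close>

definition rotate_set :: "(real^2) set \<Rightarrow> (real^2) set \<Rightarrow> (real^2) set" where
  "rotate_set \<Theta> E = {rot t *v x | t x. circle_point t \<in> \<Theta> \<and> x \<in> E}"

lemma rot_cong: "circle_point s = circle_point t \<Longrightarrow> rot s = rot t"
  by (simp add: circle_point_def rot_def vec_eq_iff forall_2)

lemma circle_point_in_sphere: "circle_point t \<in> sphere 0 1"
  by (simp add: circle_point_def norm_vec_def L2_set_def sum_2)

lemma rotation_matrix_rot: "rotation_matrix (rot t)"
  by (simp add: rotation_matrix_def orthogonal_matrix rot_def det_2 vec_eq_iff forall_2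
      matrix_matrix_mult_def transpose_def mat_def sum_2 flip: power2_eq_square)

lemma rot_circle_point: "rot s *v circle_point t = circle_point (s + t)"
  by (simp add: rot_def circle_point_def vec_eq_iff forall_2 matrix_vector_mult_def sum_2
      cos_add sin_add algebra_simps)

end

theory Submission
  imports Defs
begin

text \<open>Rotating the point rather than the set, the claim is that every long enough arc of fixed angle of
  a circle about the origin passes within \<open>\<epsilon>\<close> of the lattice. Near any direction there is a direction
  \<open>e\<close> and a lattice vector \<open>v\<close> with \<open>0 < v \<bullet> e < \<epsilon>\<close>; walking along the lattice by steps \<open>v\<close> from a
  point far out in direction \<open>e\<close>, the distance to the origin grows by less than \<open>\<epsilon>\<close> at each step and so
  comes close to any prescribed radius. Compactness of the circle makes this uniform in the direction.\<close>

section \<open>Arcs of the unit circle contain relatively open pieces\<close>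

lemma norm_circle_point [simp]: "norm (circle_point t) = 1"
  using circle_point_in_sphere[of t] by simp

lemma unit_vector_circle_point:
  fixes x :: "real^2"
  assumes "norm x = 1"
  obtains t where "0 \<le> t" "t < 2 * pi" "x = circle_point t"
proof -
  have "(x $ 1)\<^sup>2 + (x $ 2)\<^sup>2 = 1"
    using assms by (simp add: norm_vec_def L2_set_def sum_2)
  then obtain t where "0 \<le> t" "t < 2 * pi" "x $ 1 = cos t" "x $ 2 = sin t"
    using sincos_total_2pi by metis
  then show thesis
    by (intro that[of t]) (auto simp: circle_point_def vec_eq_iff forall_2)
qed

lemma inj_on_circle_point: "inj_on circle_point {0..<2 * pi}"
proof (rule inj_onI)
  fix s t assume st: "s \<in> {0..<2 * pi}" "t \<in> {0..<2 * pi}"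
    and eq: "circle_point s = circle_point t"
  then have "sin s = sin t \<and> cos s = cos t"
    by (simp add: circle_point_def vec_eq_iff forall_2)
  then obtain n :: int where n: "s = t + 2 * pi * of_int n"
    using sin_cos_eq_iff[of s t] by auto
  have "2 * pi * of_int n < 2 * pi * 1" "2 * pi * (-1) < 2 * pi * of_int n"
    using st n unfolding atLeastLessThan_iff by linarith+
  then have "real_of_int n < 1" "-1 < real_of_int n"
    using mult_less_cancel_left_pos[of "2 * pi" "of_int n" 1]
      mult_less_cancel_left_pos[of "2 * pi" "- 1" "of_int n"] pi_gt_zero by linarith+
  then show "s = t" using n by simp
qed

text \<open>Positive length enters only here: by injectivity of the parametrisation, a set with at
  most one point has a finite, hence null, set of angles.\<close>

lemma circle_arc_two_points:
  assumes "circle_arc \<Theta>"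
  obtains p q where "p \<in> \<Theta>" "q \<in> \<Theta>" "p \<noteq> q"
proof -
  have "\<not> (\<exists>p. \<Theta> \<subseteq> {p})"
  proof
    assume "\<exists>p. \<Theta> \<subseteq> {p}"
    then obtain p where p: "\<Theta> \<subseteq> {p}" ..
    let ?T = "{t \<in> {0..<2 * pi}. circle_point t \<in> \<Theta>}"
    have "finite (circle_point ` ?T)"
      by (rule finite_subset[of _ "{p}"]) (use p in auto)
    then have "finite ?T"
      by (rule finite_imageD) (rule inj_on_subset[OF inj_on_circle_point], auto)
    then have "emeasure lborel ?T = 0"
      by (intro emeasure_lborel_countable countable_finite)
    then show False using assms by (simp add: circle_arc_def circle_length_def)
  qed
  then show thesis using that by blast
qed

text \<open>The vector \<open>(- d $ 2, d $ 1)\<close> is \<open>d\<close> turned by a right angle,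
  so the level lines of the product with it run in direction \<open>d\<close>. The parameter
  \<open>s\<close> comes from projecting \<open>x - u\<close> orthogonally onto
  \<open>d\<close>.\<close>

lemma orthogonal_on_line:
  fixes u d x :: "real^2"
  assumes "d \<noteq> 0" and "vector [- (d $ 2), d $ 1] \<bullet> x = (vector [- (d $ 2), d $ 1] :: real^2) \<bullet> u"
  obtains s where "x = u + s *\<^sub>R d"
proof -
  have nz: "(d $ 1)\<^sup>2 + (d $ 2)\<^sup>2 \<noteq> 0"
    using assms(1) by (auto simp: vec_eq_iff forall_2 sum_power2_eq_zero_iff)
  have eq: "d $ 1 * (x $ 2 - u $ 2) = d $ 2 * (x $ 1 - u $ 1)"
    using assms(2) by (simp add: inner_vec_def sum_2 algebra_simps)
  define s where "s = ((x $ 1 - u $ 1) * d $ 1 + (x $ 2 - u $ 2) * d $ 2) / ((d $ 1)\<^sup>2 + (d $ 2)\<^sup>2)"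
  have 1: "s * ((d $ 1)\<^sup>2 + (d $ 2)\<^sup>2) = (x $ 1 - u $ 1) * d $ 1 + (x $ 2 - u $ 2) * d $ 2"
    using nz by (simp add: s_def)
  have "((d $ 1)\<^sup>2 + (d $ 2)\<^sup>2) * (s * d $ 1) = ((d $ 1)\<^sup>2 + (d $ 2)\<^sup>2) * (x $ 1 - u $ 1)"
    using 1 eq by algebra
  moreover have "((d $ 1)\<^sup>2 + (d $ 2)\<^sup>2) * (s * d $ 2) = ((d $ 1)\<^sup>2 + (d $ 2)\<^sup>2) * (x $ 2 - u $ 2)"
    using 1 eq by algebra
  ultimately have "s * d $ 1 = x $ 1 - u $ 1" "s * d $ 2 = x $ 2 - u $ 2"
    using nz by (simp_all only: mult_cancel_left) auto
  then show thesis by (intro that[of s]) (simp add: vec_eq_iff forall_2)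
qed

text \<open>The sign of \<open>s * (1 - s)\<close> locates a point of the line \<open>pq\<close>
  relative to the circle: on it only at \<open>p\<close> and \<open>q\<close>, inside it only
  strictly between them.\<close>

lemma norm_sq_on_chord:
  fixes p q :: "'a::real_inner"
  assumes "norm p = 1" "norm q = 1"
  shows "(norm (p + s *\<^sub>R (q - p)))\<^sup>2 = 1 - s * (1 - s) * (norm (q - p))\<^sup>2"
proof -
  have "p \<bullet> p = 1" "q \<bullet> q = 1"
    using assms by (simp_all add: dot_square_norm)
  then show ?thesis
    by (simp add: power2_norm_eq_inner inner_add_left inner_add_right inner_diff_left
        inner_diff_right inner_commute[of q p] algebra_simps)
qed

text \<open>If both open arcs cut off by the chord \<open>pq\<close> had points \<open>u\<close>, \<open>w\<close> outside \<open>\<Theta>\<close>, the line \<open>uw\<close> would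
  separate \<open>p\<close> from \<open>q\<close> inside \<open>\<Theta>\<close>.\<close>

lemma connected_circle_open_part:
  fixes \<Theta> :: "(real^2) set"
  assumes conn: "connected \<Theta>" and sub: "\<Theta> \<subseteq> sphere 0 1"
    and pq: "p \<in> \<Theta>" "q \<in> \<Theta>" "p \<noteq> q"
  obtains c \<delta> where "\<delta> > 0" "c \<in> sphere 0 1" "ball c \<delta> \<inter> sphere 0 1 \<subseteq> \<Theta>"
proof -
  have p1: "norm p = 1" and q1: "norm q = 1" using pq sub by auto
  define d where "d = q - p"
  define n :: "real^2" where "n = vector [- (d $ 2), d $ 1]"
  have d0: "d \<noteq> 0" using pq by (simp add: d_def)
  have n0: "n \<noteq> 0" using d0 by (auto simp: n_def vec_eq_iff forall_2)
  have nq: "n \<bullet> q = n \<bullet> p" by (simp add: n_def d_def inner_vec_def sum_2 algebra_simps)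
  have two: "(\<forall>x\<in>sphere 0 1. n \<bullet> x > n \<bullet> p \<longrightarrow> x \<in> \<Theta>) \<or> (\<forall>x\<in>sphere 0 1. n \<bullet> x < n \<bullet> p \<longrightarrow> x \<in> \<Theta>)"
  proof (rule ccontr)
    assume "\<not> ?thesis"
    then obtain u w where u: "norm u = 1" "u \<notin> \<Theta>" "n \<bullet> u > n \<bullet> p"
      and w: "norm w = 1" "w \<notin> \<Theta>" "n \<bullet> w < n \<bullet> p" by auto
    define f where "f = w - u"
    define m :: "real^2" where "m = vector [- (f $ 2), f $ 1]"
    have f0: "f \<noteq> 0" using u w by (auto simp: f_def)
    \<comment> \<open>The line \<open>uw\<close> meets the circle only in \<open>u\<close> and
      \<open>w\<close>, both outside \<Theta>.\<close>
    have avoid: "m \<bullet> x \<noteq> m \<bullet> u" if "x \<in> \<Theta>" for x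
    proof
      assume "m \<bullet> x = m \<bullet> u"
      then obtain s where s: "x = u + s *\<^sub>R f"
        using orthogonal_on_line[OF f0] unfolding m_def by metis
      have "s * (1 - s) * (norm f)\<^sup>2 = 0"
        using norm_sq_on_chord[OF u(1) w(1), of s] s that sub by (auto simp: f_def)
      then have "s = 0 \<or> s = 1" using f0 by simp
      then have "x = u \<or> x = w" using s by (auto simp: f_def)
      then show False using u w that by auto
    qed
    \<comment> \<open>The parameter at which the segment \<open>uw\<close> crosses the line
      \<open>pq\<close>, at the point \<open>z\<close>.\<close>
    define t where "t = (n \<bullet> u - n \<bullet> p) / (n \<bullet> u - n \<bullet> w)"
    have t: "0 < t" "t < 1" using u w by (auto simp: t_def)
    define z where "z = u + t *\<^sub>R f"
    have "t * (n \<bullet> u - n \<bullet> w) = n \<bullet> u - n \<bullet> p" using u w by (simp add: t_def)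
    then have "n \<bullet> z = n \<bullet> p" by (simp add: z_def f_def inner_simps algebra_simps)
    then obtain s where s: "z = p + s *\<^sub>R d"
      using orthogonal_on_line[OF d0] unfolding n_def by metis
    \<comment> \<open>As an inner point of the chord \<open>uw\<close>, \<open>z\<close> lies inside
      the disc, so it is also an inner point of the chord \<open>pq\<close>.\<close>
    have "t * (1 - t) * (norm f)\<^sup>2 > 0" using t f0 by simp
    then have "s * (1 - s) * (norm d)\<^sup>2 > 0"
      using norm_sq_on_chord[OF u(1) w(1), of t] norm_sq_on_chord[OF p1 q1, of s] s
      by (simp add: z_def f_def d_def)
    then have "s * (1 - s) > 0" using d0 by (simp add: zero_less_mult_iff)
    then have s01: "0 < s" "s < 1" by (auto simp: zero_less_mult_iff)
    have "m \<bullet> f = 0" by (simp add: m_def inner_vec_def sum_2)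
    then have "m \<bullet> z = m \<bullet> u" by (simp add: z_def inner_simps)
    \<comment> \<open>A convex combination of \<open>p\<close> and \<open>q\<close> lies on the line
      \<open>uw\<close>, so the two have opposite signed distances from it.\<close>
    then have bal: "(1 - s) * (m \<bullet> p - m \<bullet> u) = - s * (m \<bullet> q - m \<bullet> u)"
      unfolding s d_def by (simp add: inner_simps algebra_simps)
    have "(m \<bullet> p < m \<bullet> u \<and> m \<bullet> u < m \<bullet> q) \<or> (m \<bullet> q < m \<bullet> u \<and> m \<bullet> u < m \<bullet> p)"
    proof (cases "m \<bullet> p < m \<bullet> u")
      case True
      then have "(1 - s) * (m \<bullet> p - m \<bullet> u) < 0" using s01 by (simp add: mult_less_0_iff)
      then show ?thesis using True s01 bal by (simp add: zero_less_mult_iff)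
    next
      case False
      then have *: "m \<bullet> u < m \<bullet> p" using avoid[OF pq(1)] by simp
      then have "(1 - s) * (m \<bullet> p - m \<bullet> u) > 0" using s01 by simp
      then show ?thesis using * s01 bal by (simp add: mult_less_0_iff)
    qed
    then obtain x where "x \<in> \<Theta>" "m \<bullet> x = m \<bullet> u"
      using connected_ivt_hyperplane[OF conn pq(1,2), of m "m \<bullet> u"]
        connected_ivt_hyperplane[OF conn pq(2,1), of m "m \<bullet> u"] by force
    then show False using avoid by blast
  qed
  \<comment> \<open>Equality in Cauchy-Schwarz at both \<open>p\<close> and \<open>q\<close> would
    make both equal to \<open>k / norm k\<close>. Hence the cap beyond the chord contains its own
    centre.\<close>
  have bound: "k \<bullet> p < norm k" if "k \<bullet> q = k \<bullet> p" "k \<noteq> 0" for k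
  proof (rule ccontr)
    assume "\<not> ?thesis"
    then have "k \<bullet> p = norm k * norm p" "k \<bullet> q = norm k * norm q"
      using norm_cauchy_schwarz[of k p] p1 q1 that by auto
    then have "norm k *\<^sub>R p = norm k *\<^sub>R q"
      using norm_cauchy_schwarz_eq[of k p] norm_cauchy_schwarz_eq[of k q] p1 q1 by simp
    then show False using that pq by simp
  qed
  \<comment> \<open>Taking \<open>n\<close> or \<open>- n\<close> as \<open>k\<close> merges the two
    alternatives.\<close>
  have "\<exists>k. k \<noteq> 0 \<and> k \<bullet> q = k \<bullet> p \<and> (\<forall>x\<in>sphere 0 1. k \<bullet> x > k \<bullet> p \<longrightarrow> x \<in> \<Theta>)"
    using two
  proof
    assume "\<forall>x\<in>sphere 0 1. n \<bullet> x < n \<bullet> p \<longrightarrow> x \<in> \<Theta>"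
    then show ?thesis using n0 nq by (intro exI[of _ "- n"]) auto
  qed (use n0 nq in blast)
  then obtain k where k: "k \<noteq> 0" "k \<bullet> q = k \<bullet> p" "\<forall>x\<in>sphere 0 1. k \<bullet> x > k \<bullet> p \<longrightarrow> x \<in> \<Theta>"
    by blast
  let ?c = "k /\<^sub>R norm k"
  have "k \<bullet> ?c = norm k" using k(1) by (simp add: dot_square_norm power2_eq_square)
  then have "?c \<in> {x. k \<bullet> x > k \<bullet> p}" using bound[OF k(2,1)] by simp
  then obtain \<delta> where "\<delta> > 0" "ball ?c \<delta> \<subseteq> {x. k \<bullet> x > k \<bullet> p}"
    using open_halfspace_gt[of "k \<bullet> p" k] open_contains_ball by metis
  then show thesis using k by (intro that[of \<delta> ?c]) auto
qed

section \<open>Lattice vectors: covering radius and small projections\<close>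

lemma lattice_of_add:
  assumes "v \<in> lattice_of A" "w \<in> lattice_of A"
  shows "v + w \<in> lattice_of A"
proof -
  obtain y z where "v = A *v y" "w = A *v z" "\<forall>i. y $ i \<in> \<int>" "\<forall>i. z $ i \<in> \<int>"
    using assms by (auto simp: lattice_of_def)
  then show ?thesis
    unfolding lattice_of_def by (intro image_eqI[of _ _ "y + z"]) (auto simp: matrix_vector_right_distrib)
qed

lemma lattice_of_uminus:
  assumes "v \<in> lattice_of A"
  shows "- v \<in> lattice_of A"
proof -
  obtain y where "v = A *v y" "\<forall>i. y $ i \<in> \<int>"
    using assms by (auto simp: lattice_of_def)
  then show ?thesis
    unfolding lattice_of_def by (intro image_eqI[of _ _ "- y"]) (auto simp: matrix_vector_mult_def vec_eq_iff sum_negf)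
qed

text \<open>Rounding down the coordinates with respect to the columns of \<open>A\<close> changes
  the coordinate vector by at most 2, one for each entry; \<open>A\<close> stretches this by at most
  its operator norm.\<close>

lemma lattice_of_covering_radius:
  assumes "invertible A"
  obtains C where "C \<ge> 0" "\<And>x. \<exists>l\<in>lattice_of A. norm (l - x) \<le> C"
proof -
  let ?C = "onorm ((*v) A) * 2"
  show thesis
  proof (rule that[of ?C])
    have bl: "bounded_linear ((*v) A)" by simp
    show "?C \<ge> 0" using onorm_pos_le[OF bl] by simp
    fix x
    obtain B where "A ** B = mat 1" using assms by (auto simp: invertible_def)
    then have x: "x = A *v (B *v x)" by (simp add: matrix_vector_mul_assoc)
    define z where "z = B *v x"
    define y :: "real^2" where "y = (\<chi> i. of_int \<lfloor>z $ i\<rfloor>)"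
    have "norm (y - z) \<le> (\<Sum>i\<in>UNIV. \<bar>(y - z) $ i\<bar>)" by (rule norm_le_l1_cart)
    also have "\<dots> \<le> (\<Sum>i\<in>(UNIV :: 2 set). 1)"
      by (rule sum_mono) (simp add: y_def; linarith)
    finally have "norm (y - z) \<le> 2" by simp
    have "norm (A *v y - x) = norm (A *v (y - z))"
      using x by (simp add: z_def matrix_vector_mult_diff_distrib)
    also have "\<dots> \<le> onorm ((*v) A) * norm (y - z)" by (rule onorm[OF bl])
    also have "\<dots> \<le> ?C" using \<open>norm (y - z) \<le> 2\<close> onorm_pos_le[OF bl] by (intro mult_left_mono)
    finally show "\<exists>l\<in>lattice_of A. norm (l - x) \<le> ?C"
      by (intro bexI[of _ "A *v y"]) (auto simp: lattice_of_def y_def)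
  qed
qed

text \<open>The products with \<open>e\<close> are the integer combinations of \<open>a\<close> and
  \<open>b\<close>; Dirichlet approximation of \<open>a / b\<close> makes a nontrivial one
  small.\<close>

lemma lattice_of_almost_orthogonal:
  fixes e :: "real^2"
  assumes "invertible A" "\<epsilon> > 0"
  obtains v where "v \<in> lattice_of A" "v \<noteq> 0" "\<bar>v \<bullet> e\<bar> < \<epsilon>"
proof -
  define a b where "a = (A *v axis 1 1) \<bullet> e" and "b = (A *v axis 2 1) \<bullet> e"
  have "\<exists>x y :: int. (x \<noteq> 0 \<or> y \<noteq> 0) \<and> \<bar>of_int x * a + of_int y * b\<bar> < \<epsilon>"
  proof (cases "b = 0")
    case True
    then show ?thesis using \<open>\<epsilon> > 0\<close> by (intro exI[of _ 0] exI[of _ 1]) simp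
  next
    case False
    \<comment> \<open>This choice makes \<open>\<bar>b\<bar> / N\<close>, the bound obtained after
      multiplying the Dirichlet error by \<open>\<bar>b\<bar>\<close>, smaller than
      \<epsilon>.\<close>
    obtain N :: nat where N: "real N > \<bar>b\<bar> / \<epsilon>" using reals_Archimedean2 by blast
    have "\<bar>b\<bar> / \<epsilon> > 0" using False \<open>\<epsilon> > 0\<close> by simp
    then have "N > 0" using N by (cases N) auto
    then obtain h k where hk: "0 < k" "\<bar>of_int k * (a / b) - of_int h\<bar> < 1 / N"
      using Dirichlet_approx[of N "a / b"] by metis
    have "\<bar>of_int k * a + of_int (- h) * b\<bar> = \<bar>b\<bar> * \<bar>of_int k * (a / b) - of_int h\<bar>"
      using False by (simp add: field_simps flip: abs_mult)
    also have "\<dots> < \<bar>b\<bar> * (1 / N)" using hk False by (intro mult_strict_left_mono) auto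
    also have "\<dots> < \<epsilon>" using N \<open>\<epsilon> > 0\<close> \<open>N > 0\<close> by (simp add: field_simps)
    finally show ?thesis using hk by (intro exI[of _ k] exI[of _ "- h"]) auto
  qed
  then obtain x y :: int where xy: "x \<noteq> 0 \<or> y \<noteq> 0" "\<bar>of_int x * a + of_int y * b\<bar> < \<epsilon>" by blast
  define z :: "real^2" where "z = of_int x *\<^sub>R axis 1 1 + of_int y *\<^sub>R axis 2 1"
  have z: "z = vector [of_int x, of_int y]"
    by (simp add: z_def vec_eq_iff forall_2 axis_def)
  show thesis
  proof (rule that[of "A *v z"])
    show "A *v z \<in> lattice_of A" by (auto simp: lattice_of_def z forall_2)
    have "z \<noteq> 0" using xy(1) by (auto simp: z vec_eq_iff forall_2)
    then show "A *v z \<noteq> 0"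
      using assms(1) by (metis invertible_def matrix_vector_mul_assoc matrix_vector_mul_lid matrix_vector_mult_0_right)
    show "\<bar>(A *v z) \<bullet> e\<bar> < \<epsilon>"
      using xy(2) by (simp add: z_def a_def b_def matrix_vector_right_distrib matrix_vector_mult_scaleR inner_simps)
  qed
qed

text \<open>Strict positivity is what lets a walk by steps \<open>v\<close> progress outwards. A
  vector orthogonal to \<open>e\<close> gives no progress, which is why the direction may be
  perturbed to \<open>e'\<close>.\<close>

lemma lattice_of_small_projection:
  fixes e :: "real^2"
  assumes "invertible A" "\<epsilon> > 0" "\<delta> > 0" "norm e = 1"
  obtains e' v where "norm e' = 1" "dist e' e < \<delta>" "v \<in> lattice_of A" "0 < v \<bullet> e'" "v \<bullet> e' < \<epsilon>"
proof -
  obtain v where v: "v \<in> lattice_of A" "v \<noteq> 0" "\<bar>v \<bullet> e\<bar> < \<epsilon>"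
    using lattice_of_almost_orthogonal[OF assms(1,2)] .
  consider "v \<bullet> e > 0" | "v \<bullet> e < 0" | "v \<bullet> e = 0" by linarith
  then show thesis
  proof cases
    case 1
    then show ?thesis using v assms by (intro that[of e v]) auto
  next
    case 2
    then show ?thesis using v assms lattice_of_uminus by (intro that[of e "- v"]) auto
  next
    case 3
    txt \<open>Turning \<open>e\<close> slightly towards \<open>v\<close> makes the product positive.\<close>
    define g where "g = (\<lambda>h. cos h *\<^sub>R e + (sin h / norm v) *\<^sub>R v)"
    have "(g \<longlongrightarrow> g 0) (at_right 0)" "((\<lambda>h. v \<bullet> g h) \<longlongrightarrow> v \<bullet> g 0) (at_right 0)"
      unfolding g_def using v by (intro tendsto_intros; simp)+
    then have "\<forall>\<^sub>F h in at_right 0. dist (g h) e < \<delta>" "\<forall>\<^sub>F h in at_right 0. v \<bullet> g h < \<epsilon>"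
      using 3 assms by (auto simp: g_def dest: tendstoD order_tendstoD)
    moreover have "\<forall>\<^sub>F h in at_right (0::real). 0 < h \<and> h < pi"
      using eventually_at_right_real[OF pi_gt_zero] by (auto elim: eventually_mono)
    ultimately have "\<forall>\<^sub>F h in at_right 0. dist (g h) e < \<delta> \<and> v \<bullet> g h < \<epsilon> \<and> 0 < h \<and> h < pi"
      by eventually_elim auto
    then obtain h where h: "dist (g h) e < \<delta>" "v \<bullet> g h < \<epsilon>" "0 < h" "h < pi"
      using eventually_happens'[OF trivial_limit_at_right_real] by blast
    have "e \<bullet> e = 1" "v \<bullet> v = (norm v)\<^sup>2"
      using assms by (simp_all add: dot_square_norm)
    then have "g h \<bullet> g h = (cos h)\<^sup>2 + (sin h)\<^sup>2" and pos: "v \<bullet> g h = sin h * norm v"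
      using 3 v by (simp_all add: g_def inner_simps inner_commute[of e v] power2_eq_square)
    then have "norm (g h) = 1" by (simp add: norm_eq_1)
    moreover have "v \<bullet> g h > 0" using pos h v sin_gt_zero by simp
    ultimately show ?thesis using h v that by blast
  qed
qed

section \<open>Lattice points close to large circles\<close>

lemma dist_normalize_le:
  fixes e P :: "'a::real_normed_vector"
  assumes "norm e = 1" "norm (P - \<rho> *\<^sub>R e) \<le> K" "K < \<rho>"
  shows "P \<noteq> 0" "norm (P /\<^sub>R norm P - e) \<le> 2 * K / (\<rho> - K)"
proof -
  have K: "K \<ge> 0" using assms(2) norm_ge_zero order_trans by blast
  have r: "norm (\<rho> *\<^sub>R e) = \<rho>" using assms K by simp
  have 1: "\<bar>norm P - \<rho>\<bar> \<le> K" using norm_triangle_ineq3[of P "\<rho> *\<^sub>R e"] r assms(2) by linarith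
  then have 2: "norm P \<ge> \<rho> - K" by linarith
  then show P: "P \<noteq> 0" using assms(3) by auto
  have "P /\<^sub>R norm P - e = (P - norm P *\<^sub>R e) /\<^sub>R norm P"
    using P by (simp add: algebra_simps)
  then have eq: "norm (P /\<^sub>R norm P - e) = norm (P - norm P *\<^sub>R e) / norm P"
    by (simp add: divide_inverse mult.commute)
  \<comment> \<open>Both summands have norm at most \<open>K\<close>: the first by assumption, the
    second because \<open>norm P\<close> differs from \<rho> by at most \<open>K\<close>.\<close>
  have "P - norm P *\<^sub>R e = (P - \<rho> *\<^sub>R e) + (\<rho> - norm P) *\<^sub>R e" by (simp add: algebra_simps)
  then have "norm (P - norm P *\<^sub>R e) \<le> norm (P - \<rho> *\<^sub>R e) + norm ((\<rho> - norm P) *\<^sub>R e)"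
    by (metis norm_triangle_ineq)
  also have "\<dots> \<le> 2 * K" using 1 assms by (simp add: abs_minus_commute)
  finally show "norm (P /\<^sub>R norm P - e) \<le> 2 * K / (\<rho> - K)"
    unfolding eq using 2 assms(3) K by (intro frac_le) auto
qed

text \<open>By convexity, the norm grows by at most its derivative at the endpoint in direction
  \<open>v\<close>; Cauchy-Schwarz for \<open>P\<close> and the unit vector at the endpoint proves
  it.\<close>

lemma norm_add_diff_le:
  fixes P v :: "'a::real_inner"
  assumes "P + v \<noteq> 0"
  shows "norm (P + v) - norm P \<le> v \<bullet> ((P + v) /\<^sub>R norm (P + v))"
proof -
  let ?n = "(P + v) /\<^sub>R norm (P + v)"
  have "norm ?n = 1" using assms by simp
  then have "P \<bullet> ?n \<le> norm P" using norm_cauchy_schwarz[of P ?n] by simp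
  moreover have "(P + v) \<bullet> ?n = norm (P + v)"
    using assms by (simp add: dot_square_norm power2_eq_square del: inner_add_left inner_add_right)
  ultimately show ?thesis by (simp only: inner_add_left)
qed

text \<open>Starting from a lattice point slightly inside the circle of radius \<open>r\<close>, repeatedly adding \<open>v\<close>
  raises the norm in steps shorter than \<open>\<epsilon>\<close>. The number of steps needed to leave the disc is bounded
  independently of \<open>r\<close>, so the direction hardly changes when \<open>r\<close> is large.\<close>

lemma lattice_of_near_circle_direction:
  fixes e :: "real^2"
  assumes "invertible A" "\<epsilon> > 0" "\<delta> > 0" "norm e = 1"
  obtains R where "R > 0"
    "\<And>r. r \<ge> R \<Longrightarrow> \<exists>l\<in>lattice_of A. \<exists>n. norm n = 1 \<and> dist n e < \<delta> \<and> dist l (r *\<^sub>R n) < \<epsilon>"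
proof -
  obtain e' v where e': "norm e' = 1" "dist e' e < \<delta> / 2" and v: "v \<in> lattice_of A" "0 < v \<bullet> e'" "v \<bullet> e' < \<epsilon> / 2"
    using lattice_of_small_projection[of A "\<epsilon> / 2" "\<delta> / 2" e] assms by auto
  obtain C where C: "C \<ge> 0" "\<And>x. \<exists>l\<in>lattice_of A. norm (l - x) \<le> C"
    using lattice_of_covering_radius[OF assms(1)] by blast
  \<comment> \<open>The walk starts with component at least \<open>r - 2 * C\<close> along
    \<open>e'\<close>, so \<open>M\<close> steps carry it past \<open>r\<close>.\<close>
  obtain M :: nat where M: "2 * C < real M * (v \<bullet> e')"
    using reals_Archimedean3[OF v(2)] by blast
  \<comment> \<open>Bounds the distance from \<open>\<rho> *\<^sub>R e'\<close> of every point
    reached within \<open>M\<close> steps.\<close>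
  define K where "K = C + real M * norm v"
  have K: "K \<ge> 0" using C by (simp add: K_def)
  \<comment> \<open>Tolerance for the deviation from \<open>e'\<close>: the first bound keeps
    directions within \<delta> of \<open>e\<close>, the second lets the deviation add at most
    \<open>\<epsilon> / 2\<close> to the growth of the norm in one step.\<close>
  define \<eta> where "\<eta> = min (\<delta> / 2) (\<epsilon> / (2 * (norm v + 1)))"
  have nv: "0 < norm v + 1" using norm_ge_zero[of v] by linarith
  have \<eta>: "\<eta> > 0" "\<eta> \<le> \<delta> / 2"
    unfolding \<eta>_def using assms nv by simp (rule min.cobounded1)
  have "\<eta> \<le> \<epsilon> / (2 * (norm v + 1))" by (simp add: \<eta>_def)
  then have \<eta>2: "(norm v + 1) * \<eta> \<le> \<epsilon> / 2" using nv by (simp add: field_simps)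
  show thesis
  \<comment> \<open>Chosen so that \<open>\<rho> - K\<close> exceeds \<open>2 * K / \<eta>\<close>,
    which brings the error in \<open>dist_normalize_le\<close> below \<eta>.\<close>
  proof (rule that[of "C + K + 2 * K / \<eta> + 1"])
    show "C + K + 2 * K / \<eta> + 1 > 0" using C K \<eta> by (simp add: add_nonneg_pos)
    fix r assume r: "r \<ge> C + K + 2 * K / \<eta> + 1"
    \<comment> \<open>Aiming at radius \<open>r - C\<close> ensures that a lattice point within
      \<open>C\<close> of the target has norm at most \<open>r\<close>.\<close>
    define \<rho> where "\<rho> = r - C"
    have "2 * K / \<eta> \<ge> 0" using K \<eta> by simp
    then have \<rho>: "K < \<rho>" "2 * K / \<eta> < \<rho> - K" using r by (auto simp: \<rho>_def)
    then have small: "2 * K / (\<rho> - K) < \<eta>" using \<eta> by (simp add: field_simps)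
    obtain P where P: "P \<in> lattice_of A" "norm (P - \<rho> *\<^sub>R e') \<le> C" using C(2) by blast
    define Q where "Q = (\<lambda>m::nat. P + real m *\<^sub>R v)"
    have Q_lat: "Q m \<in> lattice_of A" for m
    proof (induction m)
      case (Suc m)
      have "Q (Suc m) = Q m + v" by (simp add: Q_def algebra_simps)
      then show ?case using Suc v lattice_of_add by metis
    qed (simp add: Q_def P)
    have Q_dir: "Q m \<noteq> 0" "norm (Q m /\<^sub>R norm (Q m) - e') < \<eta>" if "m \<le> M" for m
    proof -
      have "norm (Q m - \<rho> *\<^sub>R e') \<le> norm (P - \<rho> *\<^sub>R e') + norm (real m *\<^sub>R v)"
        unfolding Q_def using norm_triangle_ineq[of "P - \<rho> *\<^sub>R e'" "real m *\<^sub>R v"] by (simp add: algebra_simps)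
      also have "\<dots> \<le> K" unfolding K_def using P that by (intro add_mono) (auto intro: mult_right_mono)
      finally have "norm (Q m - \<rho> *\<^sub>R e') \<le> K" .
      from dist_normalize_le[OF e'(1) this \<rho>(1)] small
      show "Q m \<noteq> 0" "norm (Q m /\<^sub>R norm (Q m) - e') < \<eta>" by auto
    qed
    have step: "norm (Q (Suc m)) < norm (Q m) + \<epsilon>" if "Suc m \<le> M" for m
    proof -
      let ?n = "Q (Suc m) /\<^sub>R norm (Q (Suc m))"
      have eq: "Q (Suc m) = Q m + v" by (simp add: Q_def algebra_simps)
      have "norm (Q (Suc m)) - norm (Q m) \<le> v \<bullet> ?n"
        using norm_add_diff_le[of "Q m" v] Q_dir(1)[OF that] unfolding eq by blast
      also have "\<dots> = v \<bullet> e' + v \<bullet> (?n - e')" by (simp add: inner_diff_right)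
      also have "v \<bullet> (?n - e') \<le> norm v * norm (?n - e')" by (rule norm_cauchy_schwarz)
      also have "\<dots> \<le> (norm v + 1) * \<eta>"
        using Q_dir(2)[OF that] by (intro mult_mono) auto
      finally show ?thesis using \<eta>2 v by linarith
    qed
    have rr: "norm (\<rho> *\<^sub>R e') = \<rho>" using \<rho> K e' by simp
    have start: "norm (Q 0) \<le> r"
      using norm_triangle_ineq2[of P "\<rho> *\<^sub>R e'"] P rr by (simp add: Q_def \<rho>_def)
    have "- C \<le> (P - \<rho> *\<^sub>R e') \<bullet> e'"
      using Cauchy_Schwarz_ineq2[of "P - \<rho> *\<^sub>R e'" e'] P e' by simp
    moreover have "e' \<bullet> e' = 1" using e' by (simp add: dot_square_norm)
    ultimately have "r < Q M \<bullet> e'"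
      using M by (simp add: Q_def \<rho>_def inner_simps)
    also have "\<dots> \<le> norm (Q M)" using norm_cauchy_schwarz[of "Q M" e'] e' by simp
    finally have stop: "r < norm (Q M)" .
    \<comment> \<open>The last index before the first exit from the disc; a step shorter than
      \<epsilon> crosses radius \<open>r\<close> there, so \<open>norm (Q m)\<close> is within
      \<epsilon> of \<open>r\<close>.\<close>
    obtain m where m: "m < M" "norm (Q m) \<le> r" "r < norm (Q (Suc m))"
    proof -
      define k where "k = (LEAST k. r < norm (Q k))"
      have k: "r < norm (Q k)" "k \<le> M" "\<And>j. j < k \<Longrightarrow> \<not> r < norm (Q j)"
        unfolding k_def using stop by (auto intro: LeastI Least_le dest: not_less_Least)
      then obtain j where "k = Suc j" using start by (cases k) auto
      then show thesis using k that[of j] by (auto simp: not_less)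
    qed
    let ?n = "Q m /\<^sub>R norm (Q m)"
    have Qm: "Q m \<noteq> 0" "norm (?n - e') < \<eta>" using Q_dir[of m] m by auto
    have "norm ?n = 1" using Qm by simp
    moreover have "dist ?n e < \<delta>"
      using dist_triangle[of ?n e e'] Qm(2) e'(2) \<eta> by (simp add: dist_norm)
    moreover have "dist (Q m) (r *\<^sub>R ?n) < \<epsilon>"
    proof -
      have "Q m - r *\<^sub>R ?n = (norm (Q m) - r) *\<^sub>R ?n" using Qm by (simp add: algebra_simps)
      then have "dist (Q m) (r *\<^sub>R ?n) = \<bar>norm (Q m) - r\<bar> * norm ?n"
        unfolding dist_norm by (metis norm_scaleR)
      then show ?thesis using \<open>norm ?n = 1\<close> step[of m] m by simp
    qed
    ultimately show "\<exists>l\<in>lattice_of A. \<exists>n. norm n = 1 \<and> dist n e < \<delta> \<and> dist l (r *\<^sub>R n) < \<epsilon>"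
      using Q_lat by blast
  qed
qed

text \<open>Finitely many directions, each treated with tolerance \<open>\<delta> / 2\<close>, come
  within \<open>\<delta> / 2\<close> of every direction, so the maximum of their radii serves for
  all.\<close>

lemma lattice_of_near_circle:
  assumes "invertible A" "\<epsilon> > 0" "\<delta> > 0"
  obtains R where "R > 0"
    "\<And>r e. r \<ge> R \<Longrightarrow> norm e = 1 \<Longrightarrow>
      \<exists>l\<in>lattice_of A. \<exists>n. norm n = 1 \<and> dist n e < \<delta> \<and> dist l (r *\<^sub>R n) < \<epsilon>"
proof -
  obtain F where F: "finite F" "F \<subseteq> sphere 0 1" "sphere (0::real^2) 1 \<subseteq> (\<Union>e\<in>F. ball e (\<delta> / 2))"
    using compactE_image[OF compact_sphere[of "0::real^2" 1], of "sphere 0 1" "\<lambda>e. ball e (\<delta> / 2)"] \<open>\<delta> > 0\<close>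
    by (metis UN_I centre_in_ball half_gt_zero open_ball subsetI)
  have "\<forall>e\<in>F. \<exists>R>0. \<forall>r\<ge>R. \<exists>l\<in>lattice_of A. \<exists>n. norm n = 1 \<and> dist n e < \<delta> / 2 \<and> dist l (r *\<^sub>R n) < \<epsilon>"
  proof
    fix e assume "e \<in> F"
    then have "norm e = 1" using F by auto
    then show "\<exists>R>0. \<forall>r\<ge>R. \<exists>l\<in>lattice_of A. \<exists>n. norm n = 1 \<and> dist n e < \<delta> / 2 \<and> dist l (r *\<^sub>R n) < \<epsilon>"
      using lattice_of_near_circle_direction[of A \<epsilon> "\<delta> / 2" e] assms by (metis half_gt_zero)
  qed
  then obtain R where R: "\<And>e r. e \<in> F \<Longrightarrow> r \<ge> R e \<Longrightarrow>
      \<exists>l\<in>lattice_of A. \<exists>n. norm n = 1 \<and> dist n e < \<delta> / 2 \<and> dist l (r *\<^sub>R n) < \<epsilon>"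
    by metis
  \<comment> \<open>Inserting 1 makes the maximum positive.\<close>
  show thesis
  proof (rule that[of "Max (insert 1 (R ` F))"])
    show "Max (insert 1 (R ` F)) > 0" using F by (simp add: Max_gr_iff)
    fix r and e :: "real^2" assume r: "r \<ge> Max (insert 1 (R ` F))" and e: "norm e = 1"
    then obtain f where f: "f \<in> F" "dist f e < \<delta> / 2" using F(3) by fastforce
    then have "R f \<le> r" using r F by auto
    then obtain l n where ln: "l \<in> lattice_of A" "norm n = 1" "dist n f < \<delta> / 2" "dist l (r *\<^sub>R n) < \<epsilon>"
      using R f by blast
    moreover have "dist n e < \<delta>" using dist_triangle[of n e f] f ln by simp
    ultimately show "\<exists>l\<in>lattice_of A. \<exists>n. norm n = 1 \<and> dist n e < \<delta> \<and> dist l (r *\<^sub>R n) < \<epsilon>"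
      by blast
  qed
qed

section \<open>From nearby directions to rotations by angles in the arc\<close>

lemma dist_circle_point_reflect:
  "dist (circle_point (a - s)) (circle_point (a - t)) = dist (circle_point s) (circle_point t)"
proof -
  \<comment> \<open>Chord length depends only on the cosine of the angle difference, which ignores
    the sign change made by the reflection.\<close>
  have "(dist (circle_point s) (circle_point t))\<^sup>2 = 2 - 2 * cos (s - t)" for s t
  proof -
    have "circle_point s \<bullet> circle_point t = cos (s - t)"
      by (simp add: circle_point_def inner_vec_def sum_2 cos_diff)
    moreover have "circle_point u \<bullet> circle_point u = 1" for u
      by (simp add: dot_square_norm)
    ultimately show ?thesis
      by (simp add: dist_norm power2_norm_eq_inner inner_simps inner_commute[of "circle_point t"])
  qed
  note sq = this
  have "(dist (circle_point (a - s)) (circle_point (a - t)))\<^sup>2 = (dist (circle_point s) (circle_point t))\<^sup>2"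
    using cos_minus[of "s - t"] by (simp add: sq)
  then show ?thesis by (simp add: power2_eq_iff_nonneg)
qed

theorem corollary1:
  fixes A :: "real^2^2" and \<epsilon> :: real and \<Lambda> E \<Theta> :: "(real^2) set"
  assumes "invertible A"
    and "\<Lambda> = lattice_of A"
    and "\<epsilon> > 0"
    and "E = {l + b | l b. l \<in> \<Lambda> \<and> b \<in> ball 0 \<epsilon>}"
    and "circle_arc \<Theta>"
  shows "\<exists>t\<^sub>0>0. - ball 0 t\<^sub>0 \<subseteq> rotate_set \<Theta> E"
proof -
  obtain p q where "p \<in> \<Theta>" "q \<in> \<Theta>" "p \<noteq> q"
    using circle_arc_two_points[OF assms(5)] .
  then obtain c \<delta> where \<delta>: "\<delta> > 0" and c: "c \<in> sphere 0 1" "ball c \<delta> \<inter> sphere 0 1 \<subseteq> \<Theta>"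
    using connected_circle_open_part assms(5) unfolding circle_arc_def by metis
  obtain \<theta> where \<theta>: "c = circle_point \<theta>"
    using unit_vector_circle_point[of c] c by auto
  obtain R where R: "R > 0" "\<And>r e. r \<ge> R \<Longrightarrow> norm e = 1 \<Longrightarrow>
      \<exists>l\<in>lattice_of A. \<exists>n. norm n = 1 \<and> dist n e < \<delta> \<and> dist l (r *\<^sub>R n) < \<epsilon>"
    using lattice_of_near_circle[OF assms(1,3) \<delta>] by blast
  have "x \<in> rotate_set \<Theta> E" if "x \<in> - ball 0 R" for x
  proof -
    have r: "norm x \<ge> R" "norm x > 0" using that R(1) by auto
    then have "norm (x /\<^sub>R norm x) = 1" by simp
    then obtain \<phi> where \<phi>: "x /\<^sub>R norm x = circle_point \<phi>"
      using unit_vector_circle_point by metis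
    then have x: "x = norm x *\<^sub>R circle_point \<phi>"
      using r by (simp flip: \<phi>)
    \<comment> \<open>The direction of \<open>x\<close> turned back by \<theta> is approximated by
      \<open>n\<close>, at angle \<psi>. Rotation by \<open>\<phi> - \<psi>\<close> then takes
      \<open>n\<close> exactly to the direction of \<open>x\<close>, and reflection shows this angle
      to be close to \<theta>.\<close>
    obtain l n where ln: "l \<in> \<Lambda>" "norm n = 1" "dist n (circle_point (\<phi> - \<theta>)) < \<delta>"
        "dist l (norm x *\<^sub>R n) < \<epsilon>"
      using R(2)[OF r(1), of "circle_point (\<phi> - \<theta>)"] assms(2) by auto
    obtain \<psi> where \<psi>: "n = circle_point \<psi>" using unit_vector_circle_point ln(2) by metis
    have "dist (circle_point (\<phi> - \<psi>)) c < \<delta>"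
      using ln(3) dist_circle_point_reflect[of \<phi> \<psi> "\<phi> - \<theta>"] by (simp add: \<theta> \<psi>)
    then have "circle_point (\<phi> - \<psi>) \<in> \<Theta>"
      using c by (auto simp: dist_commute)
    moreover have "norm x *\<^sub>R n \<in> E"
      unfolding assms(4) mem_Collect_eq using ln
      by (intro exI[of _ l] exI[of _ "norm x *\<^sub>R n - l"]) (simp add: dist_norm norm_minus_commute)
    moreover have "x = rot (\<phi> - \<psi>) *v (norm x *\<^sub>R n)"
      using x by (simp add: matrix_vector_mult_scaleR \<psi> rot_circle_point)
    ultimately show ?thesis unfolding rotate_set_def by blast
  qed
  then show ?thesis using R(1) by blast
qed

end
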